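(* Let $X$ be a set and let $\mathscr{A}$ and $\mathscr{B}$ be collections of families of subsets of $X$. If $X$ satisfies the principle $\mathbf{CS}_1(\mathscr{A},\mathscr{B})$, then $X$ satisfies the principle $\mathbf{S}_1^*(\mathscr{A},\mathscr{R}_{\mathscr{B}}^+)$.
   Context: For a set $Y$, $[Y]^{<\omega}$ is the collection of all finite subsets of $Y$ (including $\emptyset$; $\bigcup\emptyset=\emptyset$). For $A\subseteq X$ and a family $\mathcal{U}$ of subsets of $X$, $St(A,\mathcal{U})=\bigcup\{U\in\mathcal{U}:U\cap A\neq\emptyset\}$. For families $\mathcal{A},\mathcal{B}$ of sets, $\mathcal{A}$ refines $\mathcal{B}$, written $\mathcal{A}\prec\mathcal{B}$, if for every $A\in\mathcal{A}$ there is $B\in\mathcal{B}$ with $A\subseteq B$. For a collection $\mathscr{B}$ of families of subsets of $X$, $\mathscr{R}_{\mathscr{B}}^+=\{\mathcal{R}:\text{there exists }\mathcal{B}\in\mathscr{B}\text{ such that }\mathcal{B}\prec\mathcal{R}\}$, where $\mathcal{R}$ ranges over families of subsets of $X$. For collections $\mathscr{A},\mathscr{B}$ of families of subsets of $X$: $\mathbf{S}^*_1(\mathscr{A},\mathscr{B})$: for any sequence $\{\mathcal{A}_n:n\in\omega\}$ of elements of $\mathscr{A}$ there is a sequence $\{B_n:n\in\omega\}$ such that $B_n\in\mathcal{A}_n$ for each $n\in\omega$, and $\{St(B_n,\mathcal{A}_n):n\in\omega\}\in\mathscr{B}$. $\mathbf{CS}_1(\mathscr{A},\mathscr{B})$: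 for any sequence $\{\mathcal{U}_n:n\in\omega\}$ of elements of $\mathscr{A}$ there is a sequence $\{U_n:n\in\omega\}$ such that $U_n\in\mathcal{U}_n$ for each $n\in\omega$, and $\bigcup\{\mathcal{V}_n:n\in\omega\}\in\mathscr{B}$, where $\mathcal{V}_n=\{\bigcup\mathcal{V}:\mathcal{V}\in[\mathcal{U}_n]^{<\omega}\text{ and }U_n\cap V\neq\emptyset\text{ for each }V\in\mathcal{V}\}$. *)

theory Defs
  imports Main
begin

definition star :: "'a set \<Rightarrow> 'a set set \<Rightarrow> 'a set" where
  "star A \<U> = \<Union>{U \<in> \<U>. U \<inter> A \<noteq> {}}"

definition refines :: "'a set set \<Rightarrow> 'a set set \<Rightarrow> bool"  (infix "\<prec>" 50) where
  "\<A> \<prec> \<B> \<longleftrightarrow> (\<forall>A\<in>\<A>. \<exists>B\<in>\<B>. A \<subseteq> B)"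

definition refined_families :: "'a set \<Rightarrow> 'a set set set \<Rightarrow> 'a set set set" where
  "refined_families X \<BB> = {\<R>. \<R> \<subseteq> Pow X \<and> (\<exists>\<B>\<in>\<BB>. \<B> \<prec> \<R>)}"

definition star_S1 :: "'a set set set \<Rightarrow> 'a set set set \<Rightarrow> bool" where
  "star_S1 \<AA> \<BB> \<longleftrightarrow>
    (\<forall>\<A> :: nat \<Rightarrow> 'a set set. (\<forall>n. \<A> n \<in> \<AA>) \<longrightarrow>
      (\<exists>B :: nat \<Rightarrow> 'a set. (\<forall>n. B n \<in> \<A> n) \<and> {star (B n) (\<A> n) | n. True} \<in> \<BB>))"

(* The finite family \<V> may be empty, so {} always belongs to finite_unions_meeting. *)
definition finite_unions_meeting :: "'a set \<Rightarrow> 'a set set \<Rightarrow> 'a set set" where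
  "finite_unions_meeting U \<U> = {\<Union>\<V> | \<V>. \<V> \<in> Fpow \<U> \<and> (\<forall>V\<in>\<V>. U \<inter> V \<noteq> {})}"

definition CS1 :: "'a set set set \<Rightarrow> 'a set set set \<Rightarrow> bool" where
  "CS1 \<AA> \<BB> \<longleftrightarrow>
    (\<forall>\<U> :: nat \<Rightarrow> 'a set set. (\<forall>n. \<U> n \<in> \<AA>) \<longrightarrow>
      (\<exists>U :: nat \<Rightarrow> 'a set. (\<forall>n. U n \<in> \<U> n) \<and>
        (\<Union>n. finite_unions_meeting (U n) (\<U> n)) \<in> \<BB>))"

end

theory Submission
  imports Defs
begin

text \<open>The sets \<open>U n\<close> selected by the first principle also witness the second. A union of
  members of \<open>\<U>\<close> that all meet \<open>U\<close> lies in the star of \<open>U\<close>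
  (\<open>finite_unions_meeting_subset_star\<close>), so the family produced by the first principle
  refines the family of stars, which consists of subsets of \<open>X\<close>.\<close>

lemma star_subset_carrier:
  assumes "\<U> \<subseteq> Pow X"
  shows "star A \<U> \<subseteq> X"
  using assms by (auto simp: star_def)

lemma finite_unions_meeting_subset_star:
  assumes "W \<in> finite_unions_meeting U \<U>"
  shows "W \<subseteq> star U \<U>"
  using assms by (fastforce simp: finite_unions_meeting_def star_def Fpow_def)

theorem theorem3p3:
  fixes X :: "'a set" and \<AA> \<BB> :: "'a set set set"
  assumes "\<AA> \<subseteq> Pow (Pow X)" and "\<BB> \<subseteq> Pow (Pow X)"
    and "CS1 \<AA> \<BB>"
  shows "star_S1 \<AA> (refined_families X \<BB>)"
  unfolding star_S1_def
proof (intro allI impI)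
  fix \<U> :: "nat \<Rightarrow> 'a set set"
  assume \<U>: "\<forall>n. \<U> n \<in> \<AA>"
  with \<open>CS1 \<AA> \<BB>\<close> obtain U where U: "\<forall>n. U n \<in> \<U> n"
    and mem: "(\<Union>n. finite_unions_meeting (U n) (\<U> n)) \<in> \<BB>"
    unfolding CS1_def by blast
  let ?stars = "{star (U n) (\<U> n) | n. True}"
  have "(\<Union>n. finite_unions_meeting (U n) (\<U> n)) \<prec> ?stars"
    unfolding refines_def using finite_unions_meeting_subset_star by blast
  moreover have "?stars \<subseteq> Pow X"
  proof -
    have "\<U> n \<subseteq> Pow X" for n
      using \<U> \<open>\<AA> \<subseteq> Pow (Pow X)\<close> by blast
    then show ?thesis
      using star_subset_carrier by blast
  qed
  ultimately have "?stars \<in> refined_families X \<BB>"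
    using mem unfolding refined_families_def by blast
  with U show "\<exists>B. (\<forall>n. B n \<in> \<U> n) \<and>
      {star (B n) (\<U> n) | n. True} \<in> refined_families X \<BB>"
    by blast
qed

end
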